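(* Let $p$ be a prime, let $e\geq 1$ be an integer, and let $q=p^{e}$. Let $A\subseteq\mathbb{F}_{q}^{2}$ with $1<|A|\leq q$, and let $D\subseteq\mathbb{F}_q\cup\{\infty\}$ be the set of directions spanned by $A$. Then either $A$ is contained in a line of $\mathbb{F}_q^2$, or the following holds: (a) if $e$ is even, then $|D|>\frac{|A|}{\sqrt{q}}$; (b) if $e$ is odd, then $|D|>\frac{|A|}{p^{\frac{e-1}{2}}+1}$.
   Context: $\mathbb{F}_q$ denotes the finite field with $q$ elements. For a set $A\subseteq\mathbb{F}_q^{2}$, the set of directions spanned (or determined) by $A$ is $$D=\left\{\frac{b'-b}{a'-a}\ :\ (a,b),(a',b')\in A,\ (a,b)\neq(a',b')\right\}\subseteq\mathbb{F}_q\cup\{\infty\},$$ where by convention the fraction equals $\infty$ when $a'-a=0$. Lines are affine lines in $\mathbb{F}_q^2$. *)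

theory Defs
  imports Complex_Main "HOL-Library.Cardinality" "HOL-Computational_Algebra.Primes"
begin

(* A direction is an element of F together with a point at infinity: Some m is the
   slope m, and None is the symbol infinity. *)
definition direction :: "'a::field \<times> 'a \<Rightarrow> 'a \<times> 'a \<Rightarrow> 'a option" where
  "direction P Q =
     (if fst Q - fst P = 0 then None else Some ((snd Q - snd P) / (fst Q - fst P)))"

definition directions :: "('a::field \<times> 'a) set \<Rightarrow> 'a option set" where
  "directions A = {direction P Q |P Q. P \<in> A \<and> Q \<in> A \<and> P \<noteq> Q}"

definition is_line :: "('a::field \<times> 'a) set \<Rightarrow> bool" where
  "is_line L \<longleftrightarrow>
     (\<exists>a b c. (a, b) \<noteq> (0, 0) \<and> L = {(x, y). a * x + b * y = c})"

end

theory Submission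
  imports Defs "HOL-Number_Theory.Residues" "HOL-Computational_Algebra.Polynomial"
begin

text \<open>
  After a linear change of coordinates \<open>\<infinity>\<close> is not a direction. Let \<open>n = |A|\<close>, \<open>d = |D|\<close>, and for a
  slope \<open>y\<close> let \<open>R\<close> be the product of the \<open>X - (b - y a)\<close> over \<open>(a, b)\<close> in \<open>A\<close>. The coefficient of
  \<open>X\<^sup>i\<close> in \<open>W = X\<^sup>q mod R\<close> is a polynomial in \<open>y\<close> of degree at most \<open>q - i\<close>. If \<open>y\<close> is not a direction,
  then \<open>R\<close> divides \<open>X\<^sup>q - X\<close>, so \<open>W = X\<close>; having \<open>q - d\<close> zeros, the coefficients with \<open>i > d\<close> vanish
  identically, and \<open>deg W \<le> d\<close> for every \<open>y\<close>.

  For a direction \<open>y\<close> write \<open>X\<^sup>q - W\<close> as the \<open>P\<close>-th power of a polynomial \<open>k\<close> with nonzero derivative,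
  where \<open>P = p\<^sup>s\<close>. Comparing multiplicities of roots, \<open>R\<close> divides the \<open>P\<close>-th power of \<open>(X - W) k'\<close>,
  which gives \<open>n < (P + 1) d\<close> when \<open>s < e\<close>; and \<open>A\<close> lies on at most \<open>deg k = q / P\<close> lines of slope
  \<open>y\<close>. The first bound suffices if \<open>s < (e + 1) div 2\<close> for some direction. Otherwise \<open>A\<close> lies on few
  parallel lines in every direction, so each line in a direction of \<open>A\<close> has few points of \<open>A\<close>, and
  counting along the lines through one point of \<open>A\<close> bounds \<open>n\<close>.
\<close>

section \<open>Finite fields and \<open>p\<close>-th powers of polynomials\<close>

lemma power_CARD_eq_same:
  fixes x :: "'a :: {field, finite}"
  shows "x ^ CARD('a) = x"
proof (cases "x = 0")
  case False
  have "x * (\<Prod>y\<in>UNIV-{0}. x * y) = x * x ^ (CARD('a) - 1) * \<Prod>(UNIV-{0})"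
    by (simp add: prod.distrib mult_ac)
  moreover have "(\<Prod>y\<in>UNIV-{0}. x * y) = (\<Prod>y\<in>UNIV-{0}. y)"
    by (rule prod.reindex_bij_witness[of _ "\<lambda>y. y / x" "\<lambda>y. x * y"]) (use False in auto)
  moreover have "x * x ^ (CARD('a) - 1) = x ^ CARD('a)"
    using finite_UNIV_card_ge_0[where 'a = 'a] by (simp flip: power_Suc)
  ultimately have "x ^ CARD('a) * \<Prod>(UNIV-{0}) = x * \<Prod>(UNIV-{0})"
    by metis
  then show ?thesis
    by simp
qed auto

lemma CHAR_eq_of_CARD:
  assumes "prime p" "CARD('a :: {field, finite}) = p ^ e"
  shows "CHAR('a) = p"
proof -
  have "prime CHAR('a)"
    by (intro prime_CHAR_semidom finite_imp_CHAR_pos) auto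
  moreover have "CHAR('a) dvd p ^ e"
    using CHAR_dvd_CARD[where 'a = 'a] assms(2) by simp
  ultimately show ?thesis
    using assms(1) by (meson prime_dvd_power primes_dvd_imp_eq)
qed

text \<open>A zero derivative leaves only exponents divisible by \<open>p\<close>. The coefficients
  are \<open>p\<close>-th powers as well, since Frobenius is onto in a finite field, and the
  Frobenius identity then assembles the root.\<close>

lemma pderiv_eq_0_imp_power:
  fixes k :: "'a :: {field, finite} poly"
  assumes "prime p" "CARD('a) = p ^ e" "pderiv k = 0"
  shows "\<exists>l. k = l ^ p"
proof -
  have char: "CHAR('a) = p"
    using CHAR_eq_of_CARD assms by blast
  have "e > 0"
  proof (rule ccontr)
    assume "\<not> e > 0"
    then have "CARD('a) = 1" using assms by simp
    moreover have "card {0, 1 :: 'a} \<le> CARD('a)" by (intro card_mono) auto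
    ultimately show False by simp
  qed
  \<comment> \<open>This is the \<open>p\<close>-th root of the coefficient: one more
    \<open>p\<close>-th power makes the exponent \<open>p ^ e\<close>, the order of the
    field.\<close>
  define c where "c i = coeff k (i * p) ^ (p ^ (e - 1))" for i
  have c: "c i ^ p = coeff k (i * p)" for i
  proof -
    have "c i ^ p = coeff k (i * p) ^ (p ^ Suc (e - 1))"
      by (simp add: c_def power_mult [symmetric] mult.commute)
    then show ?thesis
      using power_CARD_eq_same[of "coeff k (i * p)"] assms(2) \<open>e > 0\<close> by simp
  qed
  define l where "l = (\<Sum>i\<le>degree k. monom (c i) i)"
  have zero: "coeff k i = 0" if "\<not> p dvd i" for i
  proof -
    from that obtain j where j: "i = Suc j" by (cases i) auto
    have "of_nat i * coeff k i = 0"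
      using coeff_pderiv[of k j] assms(3) by (simp add: j)
    moreover have "of_nat i \<noteq> (0 :: 'a)"
      using that char by (simp add: of_nat_eq_0_iff_char_dvd)
    ultimately show ?thesis by simp
  qed
  have "l ^ p = (\<Sum>i\<le>degree k. monom (c i) i ^ p)"
    unfolding l_def by (rule freshmans_dream_sum) (use assms(1) char in auto)
  also have "\<dots> = (\<Sum>i\<le>degree k. monom (coeff k (i * p)) (i * p))"
    by (simp add: monom_power c mult.commute)
  also have "\<dots> = k"
  proof (rule poly_eqI)
    fix m
    show "coeff (\<Sum>i\<le>degree k. monom (coeff k (i * p)) (i * p)) m = coeff k m"
    proof (cases "p dvd m")
      case False
      then show ?thesis by (auto simp: coeff_sum zero intro!: sum.neutral)
    next
      case True
      have "p > 0" using assms(1) prime_gt_0_nat by blast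
      from True obtain j where j: "m = j * p" by (metis dvd_def mult.commute)
      have "coeff (\<Sum>i\<le>degree k. monom (coeff k (i * p)) (i * p)) m
          = (\<Sum>i\<le>degree k. if i = j then coeff k (j * p) else 0)"
        unfolding coeff_sum by (intro sum.cong) (use \<open>p > 0\<close> j in auto)
      also have "\<dots> = (if j \<le> degree k then coeff k (j * p) else 0)"
        by simp
      also have "\<dots> = coeff k m"
      proof (cases "j \<le> degree k")
        case False
        then have "degree k < j * p"
          using \<open>p > 0\<close> by (metis le_trans linorder_not_less mult_le_mono2 nat_mult_1_right Suc_leI One_nat_def)
        then show ?thesis using False j by (simp add: coeff_eq_0)
      qed (simp add: j)
      finally show ?thesis .
    qed
  qed
  finally show ?thesis by metis
qed

section \<open>Root multiplicities in characteristic \<open>p\<close>\<close>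

hide_const (open) Coset.order

text \<open>Only an inequality can hold: in characteristic \<open>p\<close> the derivative vanishes
  to higher order when \<open>p\<close> divides the multiplicity.\<close>

lemma order_le_Suc_order_pderiv:
  fixes k :: "'a :: idom poly"
  assumes "pderiv k \<noteq> 0"
  shows "order a k \<le> Suc (order a (pderiv k))"
proof (cases "order a k")
  case (Suc n)
  obtain g where g: "k = [:-a, 1:] ^ Suc n * g"
    using order_1[of a k] Suc by (auto simp: dvd_def)
  have "[:-a, 1:] ^ n dvd pderiv k"
    unfolding g lemma_order_pderiv1 by (intro dvd_add dvd_smult dvd_mult2 dvd_mult le_imp_power_dvd) auto
  then show ?thesis
    using Suc assms by (simp add: order_divides)
qed auto

lemma prod_linear_dvd:
  fixes f :: "'a :: idom poly"
  assumes "finite S" "\<And>c. c \<in> S \<Longrightarrow> poly f c = 0"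
  shows "(\<Prod>c\<in>S. [:-c, 1:]) dvd f"
  using assms
proof (induction S)
  case (insert c S)
  then obtain g where g: "f = (\<Prod>c\<in>S. [:-c, 1:]) * g"
    by (auto simp: dvd_def)
  have "poly (\<Prod>c\<in>S. [:-c, 1:]) c \<noteq> 0"
    using insert by (auto simp: poly_prod)
  then have "poly g c = 0"
    using insert.prems[of c] g by simp
  then have "[:-c, 1:] dvd g"
    by (simp add: poly_eq_0_iff_dvd)
  then show ?case
    using insert.hyps g by (simp add: mult_dvd_mono mult.commute del: mult_pCons_left mult_pCons_right)
qed auto

text \<open>Extracting \<open>p\<close>-th roots while the derivative vanishes must stop, since each
  root divides the degree by \<open>p\<close> and keeps it positive.\<close>

lemma ex_power_pderiv_nonzero:
  fixes G :: "'a :: {field, finite} poly"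
  assumes "prime p" "CARD('a) = p ^ e" "degree G > 0"
  shows "\<exists>k s. G = k ^ (p ^ s) \<and> pderiv k \<noteq> 0"
  using assms(3)
proof (induction "degree G" arbitrary: G rule: less_induct)
  case less
  show ?case
  proof (cases "pderiv G = 0")
    case False
    then show ?thesis by (intro exI[of _ G] exI[of _ 0]) auto
  next
    case True
    then obtain l where l: "G = l ^ p"
      using pderiv_eq_0_imp_power assms(1,2) by blast
    have "p > 1" using assms(1) prime_gt_1_nat by blast
    have deg: "degree G = p * degree l"
      using l less.prems \<open>p > 1\<close> by (cases "l = 0") (auto simp: degree_power_eq power_0_left)
    with less.prems have "degree l > 0" "degree l < degree G"
      using \<open>p > 1\<close> by auto
    then obtain k s where "l = k ^ (p ^ s)" "pderiv k \<noteq> 0"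
      using less.hyps by blast
    with l show ?thesis
      by (intro exI[of _ k] exI[of _ "Suc s"]) (simp add: power_mult [symmetric] mult.commute)
  qed
qed

lemma proots_prod_linear:
  assumes "finite I"
  shows "proots (\<Prod>i\<in>I. [:- f i, 1:]) = image_mset f (mset_set I)"
  using assms by (induction I) (auto simp: proots_mult prod_zero_iff simp del: mult_pCons_left)

text \<open>Indexing by \<open>I\<close> lets roots repeat, and a repeated root is what excludes
  \<open>W = X\<close>. For \<open>s = e\<close> the polynomial \<open>k\<close> is linear, and the
  content is that \<open>f\<close> takes only one value on \<open>I\<close>.\<close>

lemma fully_reducible_divisor_bound:
  fixes f :: "'i \<Rightarrow> 'a :: {field, finite}" and W :: "'a poly"
  assumes p: "prime p" and q: "CARD('a) = p ^ e" and "finite I" and "\<not> inj_on f I"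
    and dvd: "(\<Prod>i\<in>I. [:- f i, 1:]) dvd monom 1 (p ^ e) - W"
    and W: "degree W \<le> d" "degree W < p ^ e" and "1 \<le> d"
  shows "\<exists>s\<le>e. (s < e \<longrightarrow> card I + p ^ s \<le> (p ^ s + 1) * d) \<and> card (f ` I) \<le> p ^ (e - s)"
proof -
  define R where "R = (\<Prod>i\<in>I. [:- f i, 1:])"
  define G where "G = monom 1 (p ^ e) - W"
  have char: "CHAR('a) = p"
    using CHAR_eq_of_CARD p q by blast
  have "p > 1" using p prime_gt_1_nat by blast
  have "degree (monom (1::'a) (p ^ e) + (- W)) = p ^ e"
    by (subst degree_add_eq_left) (use W in \<open>auto simp: degree_monom_eq\<close>)
  then have degG: "degree G = p ^ e"
    by (simp add: G_def)
  have RG: "R dvd G" using dvd by (simp add: R_def G_def)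
  have "degree G > 0" using degG \<open>p > 1\<close> by simp
  then obtain k s where ks: "G = k ^ (p ^ s)" and k': "pderiv k \<noteq> 0"
    using ex_power_pderiv_nonzero p q by blast
  have "k \<noteq> 0" "G \<noteq> 0" using k' \<open>degree G > 0\<close> by auto
  have degk: "p ^ s * degree k = p ^ e"
    using degG ks \<open>k \<noteq> 0\<close> by (simp add: degree_power_eq)
  have "s \<le> e"
    using degk \<open>p > 1\<close> by (metis dvd_triv_left power_dvd_imp_le)
  have "p ^ e = p ^ s * p ^ (e - s)"
    using \<open>s \<le> e\<close> by (simp flip: power_add)
  then have degk': "degree k = p ^ (e - s)"
    using degk \<open>p > 1\<close> by auto
  have root: "poly R (f i) = 0" if "i \<in> I" for i
    using that \<open>finite I\<close> by (auto simp: R_def poly_prod prod_zero_iff)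
  have Groot: "poly G a = 0" if "poly R a = 0" for a
    using RG that by (auto simp: dvd_def)
  have "card (f ` I) \<le> card {x. poly k x = 0}"
    by (intro card_mono poly_roots_finite \<open>k \<noteq> 0\<close>) (use Groot root ks in \<open>auto simp: poly_power\<close>)
  also have "\<dots> \<le> p ^ (e - s)"
    using card_poly_roots_bound[OF \<open>k \<noteq> 0\<close>] degk' by simp
  finally have lines: "card (f ` I) \<le> p ^ (e - s)" .
  \<comment> \<open>\<open>X^q - X\<close> has derivative \<open>-1\<close>, hence no double root,
    whereas two indices with the same \<open>f\<close>-value give \<open>R\<close> one.\<close>
  have neq: "[:0, 1:] - W \<noteq> 0"
  proof
    assume "[:0, 1:] - W = 0"
    then have G: "G = monom 1 (p ^ e) - [:0, 1:]" by (simp add: G_def)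
    from \<open>\<not> inj_on f I\<close> obtain i j where ij: "i \<in> I" "j \<in> I" "i \<noteq> j" "f i = f j"
      by (auto simp: inj_on_def)
    have "(\<Prod>i\<in>{i, j}. [:- f i, 1:]) dvd R"
      unfolding R_def by (intro prod_dvd_prod_subset) (use ij \<open>finite I\<close> in auto)
    then have "[:- f i, 1:] ^ Suc 1 dvd G"
      using ij RG by (auto simp: simp del: mult_pCons_left intro: dvd_trans)
    then obtain h where "G = [:- f i, 1:] ^ Suc 1 * h"
      by (auto simp: dvd_def)
    then have "poly (pderiv G) (f i) = 0"
      by (simp only: lemma_order_pderiv1) simp
    moreover have "of_nat (p ^ e) = (0 :: 'a)"
      using char q \<open>p > 1\<close> CHAR_dvd_CARD[where 'a = 'a] by (subst of_nat_eq_0_iff_char_dvd) simp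
    then have "pderiv G = - 1"
      unfolding G by (simp add: pderiv_diff pderiv_monom pderiv_pCons one_pCons del: of_nat_power)
    ultimately show False by simp
  qed
  have "card I + p ^ s \<le> (p ^ s + 1) * d" if "s < e"
  proof -
    \<comment> \<open>The extra factor \<open>X - W\<close> supplies, at each root of
      \<open>R\<close>, the one order that \<open>pderiv k\<close> may lose against
      \<open>k\<close>.\<close>
    define H where "H = ([:0, 1:] - W) ^ (p ^ s) * pderiv k ^ (p ^ s)"
    have "H \<noteq> 0" using neq k' by (simp add: H_def)
    have "R \<noteq> 0" using \<open>finite I\<close> by (auto simp: R_def prod_zero_iff)
    have pH: "proots H = repeat_mset (p ^ s) (proots ([:0, 1:] - W)) + repeat_mset (p ^ s) (proots (pderiv k))"
      unfolding H_def by (subst proots_mult) (use neq k' in \<open>auto simp: proots_power\<close>)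
    have pG: "proots G = repeat_mset (p ^ s) (proots k)"
      by (simp add: ks proots_power)
    have "proots R \<subseteq># proots H"
    proof (rule mset_subset_eqI)
      fix a
      show "count (proots R) a \<le> count (proots H) a"
      proof (cases "poly R a = 0")
        case False
        then show ?thesis using \<open>R \<noteq> 0\<close> by (simp add: order_0I)
      next
        case True
        then have "poly (monom 1 (p ^ e) - W) a = 0"
          using Groot G_def by simp
        \<comment> \<open>Since \<open>a^q = a\<close>, the polynomials \<open>X^q - W\<close> and
          \<open>X - W\<close> agree at \<open>a\<close>.\<close>
        then have "poly ([:0, 1:] - W) a = 0"
          using power_CARD_eq_same[of a] q by (simp add: poly_monom)
        then have 1: "1 \<le> order a ([:0, 1:] - W)"
          using neq by (metis order_root less_one not_less)
        have "count (proots R) a \<le> count (proots G) a"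
          using RG \<open>R \<noteq> 0\<close> \<open>G \<noteq> 0\<close> by (simp add: dvd_imp_order_le)
        also have "\<dots> = p ^ s * order a k"
          using \<open>k \<noteq> 0\<close> by (simp add: pG)
        also have "\<dots> \<le> p ^ s * (order a ([:0, 1:] - W) + order a (pderiv k))"
          using order_le_Suc_order_pderiv[OF k', of a] 1 by (intro mult_le_mono2) linarith
        also have "\<dots> = count (proots H) a"
          using neq k' by (simp add: pH algebra_simps)
        finally show ?thesis .
      qed
    qed
    then have "size (proots R) \<le> size (proots H)"
      by (rule size_mset_mono)
    then have "card I \<le> degree H"
      using size_proots_le[of H] \<open>finite I\<close> by (simp add: R_def proots_prod_linear)
    also have "degree H = p ^ s * degree ([:0, 1:] - W) + p ^ s * degree (pderiv k)"
      unfolding H_def by (subst degree_mult_eq) (use neq k' in \<open>auto simp: degree_power_eq\<close>)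
    finally have 1: "card I \<le> p ^ s * degree ([:0, 1:] - W) + p ^ s * degree (pderiv k)" .
    have 2: "degree ([:0, 1:] - W) \<le> d"
      using W \<open>1 \<le> d\<close> by (intro degree_diff_le) auto
    \<comment> \<open>Removing the leading term of \<open>k\<close> leaves a \<open>p ^ s\<close>-th
      root of \<open>-W\<close>, so \<open>degree g\<close> is at most \<open>d / p ^ s\<close>, far
      better than the bound from \<open>degree k\<close>.\<close>
    define g where "g = k - monom 1 (p ^ (e - s))"
    have "(g + monom 1 (p ^ (e - s))) ^ (p ^ s) = g ^ (p ^ s) + monom 1 (p ^ (e - s)) ^ (p ^ s)"
      by (rule freshmans_dream') (use p char in auto)
    then have "g ^ (p ^ s) = - W"
      using ks \<open>p ^ e = p ^ s * p ^ (e - s)\<close>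
      by (simp add: g_def G_def monom_power mult.commute)
    then have "degree (g ^ (p ^ s)) \<le> d"
      using W by simp
    \<comment> \<open>Here \<open>s < e\<close> enters: the exponent of the removed monomial is
      divisible by \<open>p\<close>, so \<open>g\<close> and \<open>k\<close> have the same
      derivative.\<close>
    moreover have "of_nat (p ^ (e - s)) = (0 :: 'a)"
      using char that by (subst of_nat_eq_0_iff_char_dvd) simp
    then have gk: "pderiv g = pderiv k"
      by (simp add: g_def pderiv_diff pderiv_monom del: of_nat_power)
    have "degree g \<noteq> 0"
    proof
      assume "degree g = 0"
      then obtain c where "g = [:c:]" by (rule degree_eq_zeroE)
      then show False using gk k' by (simp add: pderiv_pCons)
    qed
    moreover from this have "g \<noteq> 0" by auto
    ultimately have "p ^ s * degree g \<le> d"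
      by (simp add: degree_power_eq)
    \<comment> \<open>The drop of the degree by one, multiplied by \<open>p ^ s\<close>, is the
      summand \<open>p ^ s\<close> that later makes the point bound strict.\<close>
    moreover have "degree (pderiv g) \<le> degree g - 1"
      by (rule degree_le) (auto simp: coeff_pderiv coeff_eq_0)
    then have "degree (pderiv k) + 1 \<le> degree g"
      using gk \<open>degree g \<noteq> 0\<close> by simp
    then have "p ^ s * (degree (pderiv k) + 1) \<le> p ^ s * degree g"
      by (rule mult_le_mono2)
    ultimately have "p ^ s * degree (pderiv k) + p ^ s \<le> d"
      by (simp add: algebra_simps)
    moreover have "p ^ s * degree ([:0, 1:] - W) \<le> p ^ s * d"
      using 2 by (rule mult_le_mono2)
    ultimately show ?thesis
      using 1 unfolding distrib_right mult_1 by linarith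
  qed
  with lines \<open>s \<le> e\<close> show ?thesis by blast
qed

section \<open>Remainders whose coefficients are polynomials in the slope\<close>

text \<open>
  \<open>F\<close> encodes a polynomial in \<open>X\<close> and \<open>y\<close> of total degree at most \<open>N\<close>, with \<open>y\<close> specialised.
\<close>
definition total_degree_le :: "nat \<Rightarrow> ('a :: field \<Rightarrow> 'a poly) \<Rightarrow> bool" where
  "total_degree_le N F \<longleftrightarrow>
     (\<forall>i. \<exists>P. (\<forall>y. coeff (F y) i = poly P y) \<and> (P = 0 \<or> degree P + i \<le> N))"

lemma total_degree_le_one: "total_degree_le 0 (\<lambda>y. 1)"
  unfolding total_degree_le_def
  by (auto intro: exI[of _ 1] exI[of _ 0] simp: coeff_1)

lemma total_degree_le_diff:
  assumes "total_degree_le N F" "total_degree_le N G"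
  shows "total_degree_le N (\<lambda>y. F y - G y)"
  unfolding total_degree_le_def
proof
  fix i
  obtain P where P: "\<forall>y. coeff (F y) i = poly P y" "P = 0 \<or> degree P + i \<le> N"
    using assms(1) unfolding total_degree_le_def by blast
  obtain Q where Q: "\<forall>y. coeff (G y) i = poly Q y" "Q = 0 \<or> degree Q + i \<le> N"
    using assms(2) unfolding total_degree_le_def by blast
  have "degree (P - Q) \<le> max (degree P) (degree Q)"
    by (rule degree_diff_le_max)
  then show "\<exists>P. (\<forall>y. coeff (F y - G y) i = poly P y) \<and> (P = 0 \<or> degree P + i \<le> N)"
    by (intro exI[of _ "P - Q"]) (use P Q in \<open>auto simp: max_def split: if_splits\<close>)
qed

lemma total_degree_le_pCons:
  assumes "total_degree_le N F"
  shows "total_degree_le (Suc N) (\<lambda>y. pCons 0 (F y))"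
  unfolding total_degree_le_def
proof
  fix i
  show "\<exists>P. (\<forall>y. coeff (pCons 0 (F y)) i = poly P y) \<and> (P = 0 \<or> degree P + i \<le> Suc N)"
  proof (cases i)
    case 0
    then show ?thesis by (intro exI[of _ 0]) auto
  next
    case (Suc j)
    then show ?thesis using assms by (auto simp: total_degree_le_def)
  qed
qed

lemma total_degree_le_smult:
  assumes "total_degree_le N F" "Q = 0 \<or> degree Q + N \<le> M"
  shows "total_degree_le M (\<lambda>y. smult (poly Q y) (F y))"
  unfolding total_degree_le_def
proof
  fix i
  obtain P where P: "\<forall>y. coeff (F y) i = poly P y" "P = 0 \<or> degree P + i \<le> N"
    using assms(1) unfolding total_degree_le_def by blast
  show "\<exists>P. (\<forall>y. coeff (smult (poly Q y) (F y)) i = poly P y) \<and> (P = 0 \<or> degree P + i \<le> M)"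
    by (intro exI[of _ "Q * P"]) (use P assms(2) degree_mult_le[of Q P] in auto)
qed

text \<open>Induction on \<open>N\<close>: multiply the previous remainder by \<open>X\<close> and
  cancel the coefficient of \<open>X^n\<close> with a multiple of \<open>R y\<close>. As
  \<open>R y\<close> is monic, no division by a polynomial in \<open>y\<close> occurs.\<close>

lemma total_degree_le_monom_mod:
  assumes R: "total_degree_le n R" and deg: "\<And>y. degree (R y) = n"
    and monic: "\<And>y. lead_coeff (R y) = 1" and "n > 0"
  shows "total_degree_le N (\<lambda>y. monom 1 N mod R y)"
proof (induction N)
  case 0
  have "(\<lambda>y. monom 1 0 mod R y) = (\<lambda>y. 1)"
    using deg \<open>n > 0\<close> by (auto simp: mod_poly_less simp flip: one_poly_eq_simps)
  then show ?case
    using total_degree_le_one by simp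
next
  case (Suc N)
  define W where "W y = monom 1 N mod R y" for y
  have nz: "R y \<noteq> 0" for y using deg[of y] \<open>n > 0\<close> by auto
  \<comment> \<open>The multiplier is the coefficient of \<open>X^(n - 1)\<close>, of degree at most
    \<open>N - (n - 1)\<close> in \<open>y\<close>; times \<open>R\<close>, of total degree
    \<open>n\<close>, it stays within \<open>Suc N\<close>.\<close>
  obtain P where P: "\<forall>y. coeff (W y) (n - 1) = poly P y" "P = 0 \<or> degree P + (n - 1) \<le> N"
    using Suc.IH unfolding total_degree_le_def W_def by blast
  have "monom 1 (Suc N) mod R y = pCons 0 (W y) - smult (poly P y) (R y)" (is "_ = ?V") for y
  proof -
    have degW: "W y = 0 \<or> degree (W y) < n"
      using degree_mod_less[OF nz] deg unfolding W_def by metis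
    have "coeff ?V i = 0" if "i \<ge> n" for i
    proof (cases "i = n")
      case True
      then show ?thesis
        using P(1) monic[of y] deg[of y] \<open>n > 0\<close> by (cases n) auto
    next
      case False
      with that have "i > n" by simp
      then show ?thesis
        using degW deg[of y] by (cases i) (auto simp: coeff_eq_0)
    qed
    then have "degree ?V < degree (R y)"
      using \<open>n > 0\<close> deg[of y] by (simp add: degree_lessI)
    then have "?V = ?V mod R y"
      by (simp add: mod_poly_less)
    also have "\<dots> = pCons 0 (W y) mod R y"
      by (simp add: poly_mod_diff_left mod_smult_left)
    also have "\<dots> = ([:0, 1:] * (monom 1 N mod R y)) mod R y"
      by (simp add: W_def)
    also have "\<dots> = ([:0, 1:] * monom 1 N) mod R y"
      by (rule mod_mult_right_eq)
    finally show ?thesis by (simp add: monom_Suc)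
  qed
  moreover have "total_degree_le (Suc N) (\<lambda>y. pCons 0 (W y) - smult (poly P y) (R y))"
    by (intro total_degree_le_diff total_degree_le_pCons total_degree_le_smult[OF R])
      (use Suc.IH P \<open>n > 0\<close> in \<open>auto simp: W_def\<close>)
  ultimately show ?case by simp
qed

section \<open>The Redei polynomial and the directions of a set\<close>

definition intercept :: "'a \<Rightarrow> 'a :: field \<times> 'a \<Rightarrow> 'a" where
  "intercept y P = snd P - y * fst P"

text \<open>The Redei polynomial specialised at slope \<open>y\<close>: the multiplicity of a root
  \<open>c\<close> counts the points of \<open>A\<close> on the line of slope \<open>y\<close> with
  intercept \<open>c\<close>.\<close>

definition redei_poly :: "('a :: field \<times> 'a) set \<Rightarrow> 'a \<Rightarrow> 'a poly" where
  "redei_poly A y = (\<Prod>P\<in>A. [:- intercept y P, 1:])"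

lemma total_degree_le_redei_poly:
  assumes "finite A"
  shows "total_degree_le (card A) (redei_poly A)"
  using assms
proof (induction A)
  case empty
  then show ?case
    using total_degree_le_one by (simp add: redei_poly_def)
next
  case (insert P A)
  have "redei_poly (insert P A) y
      = pCons 0 (redei_poly A y) - smult (poly [:snd P, - fst P:] y) (redei_poly A y)" for y
    using insert.hyps by (simp add: redei_poly_def intercept_def flip: smult_minus_left)
  moreover have "total_degree_le (Suc (card A))
      (\<lambda>y. pCons 0 (redei_poly A y) - smult (poly [:snd P, - fst P:] y) (redei_poly A y))"
    by (intro total_degree_le_diff total_degree_le_pCons total_degree_le_smult[OF insert.IH] insert.IH) auto
  ultimately have "total_degree_le (Suc (card A)) (redei_poly (insert P A))"
    by presburger
  then show ?case using insert.hyps by simp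
qed

lemma degree_redei_poly: "finite A \<Longrightarrow> degree (redei_poly A y) = card A"
  by (simp add: redei_poly_def degree_prod_eq_sum_degree)

lemma lead_coeff_redei_poly: "lead_coeff (redei_poly A y) = 1"
  by (simp add: redei_poly_def lead_coeff_prod)

lemma eq_if_intercepts_eq:
  assumes "intercept y P = intercept y Q" "intercept y' P = intercept y' Q" "y \<noteq> y'"
  shows "P = Q"
proof -
  have "y * (fst P - fst Q) = snd P - snd Q" "y' * (fst P - fst Q) = snd P - snd Q"
    using assms(1,2) by (simp_all add: intercept_def algebra_simps)
  then have "(y - y') * (fst P - fst Q) = 0"
    by (simp add: left_diff_distrib)
  then show ?thesis
    using assms by (auto simp: intercept_def prod_eq_iff)
qed

lemma direction_eq_Some_iff:
  assumes "fst P \<noteq> fst Q"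
  shows "direction P Q = Some y \<longleftrightarrow> intercept y P = intercept y Q"
proof -
  have "intercept y Q - intercept y P = (snd Q - snd P) - y * (fst Q - fst P)"
    by (simp add: intercept_def algebra_simps)
  then have "intercept y P = intercept y Q \<longleftrightarrow> snd Q - snd P = y * (fst Q - fst P)"
    by (metis eq_iff_diff_eq_0)
  then show ?thesis
    using assms by (simp add: direction_def nonzero_divide_eq_eq)
qed

lemma Some_in_directions_iff:
  "Some y \<in> directions A \<longleftrightarrow> \<not> inj_on (intercept y) A"
proof
  assume "Some y \<in> directions A"
  then obtain P Q where PQ: "P \<in> A" "Q \<in> A" "P \<noteq> Q" "direction P Q = Some y"
    by (auto simp: directions_def)
  moreover have "fst P \<noteq> fst Q"
    using PQ by (auto simp: direction_def)
  ultimately show "\<not> inj_on (intercept y) A"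
    using direction_eq_Some_iff unfolding inj_on_def by blast
next
  assume "\<not> inj_on (intercept y) A"
  then obtain P Q where PQ: "P \<in> A" "Q \<in> A" "P \<noteq> Q" "intercept y P = intercept y Q"
    by (auto simp: inj_on_def)
  moreover have "fst P \<noteq> fst Q"
    using PQ by (auto simp: intercept_def prod_eq_iff)
  ultimately have "direction P Q = Some y"
    using direction_eq_Some_iff by blast
  then show "Some y \<in> directions A"
    using PQ unfolding directions_def by (metis (mono_tags, lifting) mem_Collect_eq)
qed

lemma None_in_directions_iff:
  "None \<in> directions A \<longleftrightarrow> \<not> inj_on fst A"
proof -
  have "direction P Q = None \<longleftrightarrow> fst P = fst Q" for P Q :: "'a \<times> 'a"
    by (auto simp: direction_def)
  then have "None \<in> directions A \<longleftrightarrow> (\<exists>P Q. fst P = fst Q \<and> P \<in> A \<and> Q \<in> A \<and> P \<noteq> Q)"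
    unfolding directions_def mem_Collect_eq by metis
  then show ?thesis
    unfolding inj_on_def by blast
qed

text \<open>For \<open>i > card (directions A)\<close> the coefficient of \<open>X^i\<close>, as a
  polynomial in \<open>y\<close>, has more zeros (all slopes that are not directions) than its
  degree bound \<open>q - i\<close> permits.\<close>

lemma degree_monom_mod_redei_poly_le:
  fixes A :: "('a :: {field, finite} \<times> 'a) set"
  assumes A: "1 < card A" and None: "None \<notin> directions A"
  shows "degree (monom 1 CARD('a) mod redei_poly A y) \<le> card (directions A)"
proof -
  define W where "W y = monom 1 CARD('a) mod redei_poly A y" for y
  define S where "S = {y. Some y \<in> directions A}"
  have "finite A" using A by (metis card.infinite not_less_zero)
  have "directions A = Some ` S"
    using None by (auto simp: S_def image_iff) (metis not_None_eq)
  then have card_S: "card (directions A) = card S"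
    by (simp add: card_image)
  have W_notin: "W y = [:0, 1:]" if "y \<notin> S" for y
  proof -
    have inj: "inj_on (intercept y) A"
      using that by (simp add: S_def Some_in_directions_iff)
    \<comment> \<open>For a slope that is not a direction the intercepts are distinct, so the Redei
      polynomial is a product of distinct linear factors of \<open>X^q - X\<close>.\<close>
    have "(\<Prod>c\<in>intercept y ` A. [:-c, 1:]) dvd monom 1 CARD('a) - [:0, 1:]"
      using \<open>finite A\<close> by (intro prod_linear_dvd) (auto simp: poly_monom power_CARD_eq_same)
    then have "redei_poly A y dvd monom 1 CARD('a) - [:0, 1:]"
      by (simp add: prod.reindex[OF inj] redei_poly_def)
    then have "W y = [:0, 1:] mod redei_poly A y"
      by (simp add: W_def mod_eq_dvd_iff)
    also have "\<dots> = [:0, 1:]"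
      using A \<open>finite A\<close> by (intro mod_poly_less) (simp add: degree_redei_poly)
    finally show ?thesis .
  qed
  obtain P Q where "P \<in> A" "Q \<in> A" "P \<noteq> Q"
    using A by (metis card_le_Suc0_iff_eq \<open>finite A\<close> One_nat_def linorder_not_less)
  then have "direction P Q \<in> directions A"
    unfolding directions_def by blast
  then have d: "card (directions A) \<ge> 1"
    using card_gt_0_iff[of "directions A"] by (metis One_nat_def Suc_leI empty_iff finite)
  have "total_degree_le CARD('a) W"
    unfolding W_def using A \<open>finite A\<close>
    by (intro total_degree_le_monom_mod[OF total_degree_le_redei_poly]
        degree_redei_poly lead_coeff_redei_poly) auto
  have "coeff (W y) i = 0" if i: "i > card (directions A)" for i
  proof -
    obtain P where P: "\<forall>y. coeff (W y) i = poly P y" "P = 0 \<or> degree P + i \<le> CARD('a)"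
      using \<open>total_degree_le CARD('a) W\<close> unfolding total_degree_le_def by blast
    have "P = 0"
    proof (rule ccontr)
      assume "P \<noteq> 0"
      \<comment> \<open>The remainder \<open>X\<close> has coefficient 1 at index 1; having at least
        one direction keeps \<open>i\<close> above that index.\<close>
      have "i > 1" using i d by simp
      then have "coeff (W y) i = 0" if "y \<notin> S" for y
        using W_notin[OF that] by (simp add: coeff_eq_0)
      then have "- S \<subseteq> {y. poly P y = 0}"
        using P(1) by (metis (mono_tags, lifting) ComplD mem_Collect_eq subsetI)
      then have "card (- S) \<le> card {y. poly P y = 0}"
        by (intro card_mono poly_roots_finite \<open>P \<noteq> 0\<close>)
      also have "\<dots> \<le> degree P"
        using \<open>P \<noteq> 0\<close> by (rule card_poly_roots_bound)
      finally have "card (- S) \<le> degree P" .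
      moreover have "card (- S) = CARD('a) - card S"
        by (simp add: card_Diff_subset Compl_eq_Diff_UNIV)
      moreover have "card S \<le> CARD('a)"
        by (simp add: card_mono)
      ultimately show False
        using P(2) \<open>P \<noteq> 0\<close> i card_S by auto
    qed
    then show ?thesis using P(1) by simp
  qed
  then show ?thesis
    unfolding W_def by (intro degree_le) auto
qed

section \<open>Bounds from a single direction and from lines through a point\<close>

text \<open>The remainder \<open>W\<close> meets both degree conditions of
  \<open>fully_reducible_divisor_bound\<close>: below \<open>card A\<close>, hence below
  \<open>p ^ e\<close>, and at most \<open>d\<close>. The exponent \<open>s\<close> may vary with
  \<open>y\<close>.\<close>

lemma point_bound_and_parallel_line_bound:
  fixes A :: "('a :: {field, finite} \<times> 'a) set"
  assumes "prime p" and q: "CARD('a) = p ^ e"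
    and A: "1 < card A" "card A \<le> p ^ e" and None: "None \<notin> directions A"
    and y: "Some y \<in> directions A"
  defines "d \<equiv> card (directions A)"
  shows "\<exists>s\<le>e. (s < e \<longrightarrow> card A + p ^ s \<le> (p ^ s + 1) * d)
    \<and> card (intercept y ` A) \<le> p ^ (e - s)"
proof -
  define W where "W = monom 1 (p ^ e) mod redei_poly A y"
  have "finite A" using A by (metis card.infinite not_less_zero)
  show ?thesis
  proof (rule fully_reducible_divisor_bound)
    show "(\<Prod>P\<in>A. [:- intercept y P, 1:]) dvd monom 1 (p ^ e) - W"
      unfolding W_def redei_poly_def by (rule dvd_minus_mod)
    show "degree W \<le> d"
      using degree_monom_mod_redei_poly_le[OF A(1) None] q by (simp add: W_def d_def)
    have "redei_poly A y \<noteq> 0"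
      using lead_coeff_redei_poly[of A y] by auto
    then have "W = 0 \<or> degree W < card A"
      using degree_mod_less[of "redei_poly A y"] degree_redei_poly[OF \<open>finite A\<close>] W_def by metis
    then have "degree W < card A"
      using A(1) by auto
    then show "degree W < p ^ e"
      using A(2) by linarith
    show "1 \<le> d"
      using y by (metis d_def One_nat_def Suc_leI card_gt_0_iff empty_iff finite)
    show "\<not> inj_on (intercept y) A"
      using y by (simp add: Some_in_directions_iff)
  qed (use assms \<open>finite A\<close> in auto)
qed

text \<open>The lines through a fixed point of \<open>A\<close> in the spanned directions cover
  \<open>A\<close>, and each holds at most \<open>r - 1\<close> further points.\<close>

lemma card_less_if_few_lines:
  fixes A :: "('a :: {field, finite} \<times> 'a) set"
  assumes A: "1 < card A" and None: "None \<notin> directions A"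
    and lines: "\<And>y. Some y \<in> directions A \<Longrightarrow> card (intercept y ` A) \<le> r"
    and not_line: "\<nexists>L. is_line L \<and> A \<subseteq> L"
  shows "card A < r * card (directions A)"
proof -
  define S where "S = {y. Some y \<in> directions A}"
  have "finite A" using A by (metis card.infinite not_less_zero)
  have "directions A = Some ` S"
    using None by (auto simp: S_def image_iff) (metis not_None_eq)
  then have card_S: "card (directions A) = card S"
    by (simp add: card_image)
  have joined: "\<exists>y\<in>S. intercept y Q = intercept y P" if "P \<in> A" "Q \<in> A" "P \<noteq> Q" for P Q
  proof -
    have "direction P Q \<in> directions A"
      using that unfolding directions_def by blast
    moreover from this None obtain y where y: "direction P Q = Some y"
      by (metis option.exhaust)
    ultimately have "y \<in> S" by (simp add: S_def)
    moreover have "fst P \<noteq> fst Q"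
      using y by (auto simp: direction_def)
    ultimately show ?thesis
      using direction_eq_Some_iff y by metis
  qed
  obtain P where "P \<in> A" using A by (metis all_not_in_conv card.empty not_less_zero)
  \<comment> \<open>With a single slope, every point of \<open>A\<close> would be joined to
    \<open>P\<close> along one line. The claim also shows that \<open>S\<close> is nonempty.\<close>
  have not_singleton: "\<not> S \<subseteq> {y}" for y
  proof
    assume "S \<subseteq> {y}"
    then have "intercept y Q = intercept y P" if "Q \<in> A" for Q
      using joined[OF \<open>P \<in> A\<close> that] by (cases "P = Q") auto
    then have "A \<subseteq> {(u, v). (- y) * u + 1 * v = intercept y P}"
      by (auto simp: intercept_def)
    moreover have "is_line {(u, v). (- y) * u + 1 * v = intercept y P}"
      unfolding is_line_def by (intro exI[of _ "- y"] exI[of _ 1] exI[of _ "intercept y P"]) auto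
    ultimately show False using not_line by blast
  qed
  have on_line: "card ({Q\<in>A. intercept y Q = intercept y P} - {P}) \<le> r - 1" if "y \<in> S" for y
  proof -
    obtain z where "z \<in> S" "z \<noteq> y"
      using not_singleton[of y] by blast
    \<comment> \<open>Lines of slopes \<open>y\<close> and \<open>z\<close> meet at most once, so
      points on one line of slope \<open>y\<close> lie on distinct lines of slope \<open>z\<close>,
      of which at most \<open>r\<close> meet \<open>A\<close>.\<close>
    have "inj_on (intercept z) {Q\<in>A. intercept y Q = intercept y P}"
    proof (rule inj_onI)
      fix Q Q' assume "Q \<in> {Q\<in>A. intercept y Q = intercept y P}"
        "Q' \<in> {Q\<in>A. intercept y Q = intercept y P}" "intercept z Q = intercept z Q'"
      then show "Q = Q'"
        using \<open>z \<noteq> y\<close> by (intro eq_if_intercepts_eq[of z Q Q' y]) simp_all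
    qed
    then have "card {Q\<in>A. intercept y Q = intercept y P} \<le> card (intercept z ` A)"
      using \<open>finite A\<close> by (subst card_image [symmetric]) (auto intro!: card_mono)
    also have "\<dots> \<le> r"
      using lines \<open>z \<in> S\<close> by (simp add: S_def)
    finally show ?thesis
      using \<open>P \<in> A\<close> by (simp add: card_Diff_singleton)
  qed
  have "A - {P} \<subseteq> (\<Union>y\<in>S. {Q\<in>A. intercept y Q = intercept y P} - {P})"
    using joined[OF \<open>P \<in> A\<close>] by blast
  then have "card (A - {P}) \<le> card (\<Union>y\<in>S. {Q\<in>A. intercept y Q = intercept y P} - {P})"
    using \<open>finite A\<close> by (intro card_mono) auto
  also have "\<dots> \<le> (\<Sum>y\<in>S. card ({Q\<in>A. intercept y Q = intercept y P} - {P}))"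
    by (intro card_UN_le) simp
  also have "\<dots> \<le> card S * (r - 1)"
    using on_line sum_bounded_above[of S _ "r - 1"] by simp
  finally have bound: "card A - 1 \<le> card S * (r - 1)"
    using \<open>P \<in> A\<close> by (simp add: card_Diff_singleton)
  obtain y where "y \<in> S" using not_singleton[of 0] by blast
  then obtain z where "z \<in> S" "z \<noteq> y" using not_singleton[of y] by blast
  have "card {y, z} \<le> card S"
    using \<open>y \<in> S\<close> \<open>z \<in> S\<close> by (intro card_mono) auto
  \<comment> \<open>Two slopes give strictness: \<open>card A\<close> is at most
    \<open>card S * r - card S + 1\<close>.\<close>
  then have "card S \<ge> 2" using \<open>z \<noteq> y\<close> by simp
  have "card (intercept y ` A) \<ge> 1"
    using A \<open>P \<in> A\<close> \<open>finite A\<close> by (metis One_nat_def Suc_leI card_gt_0_iff empty_iff finite_imageI image_is_empty)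
  then have "r \<ge> 1"
    using lines[of y] \<open>y \<in> S\<close> by (simp add: S_def)
  then have "card S * r = card S * (r - 1) + card S"
    by (metis add.commute le_add_diff_inverse mult_Suc_right plus_1_eq_Suc)
  then show ?thesis
    using bound \<open>card S \<ge> 2\<close> card_S by (simp add: mult.commute)
qed

section \<open>Combining the bounds and normalising coordinates\<close>

text \<open>The threshold \<open>u\<close> is \<open>e / 2\<close> rounded up, which balances the
  two alternatives: the exponents \<open>u - 1\<close> and \<open>e - u\<close> are equal for odd
  \<open>e\<close> and differ by one for even \<open>e\<close>.\<close>

lemma direction_bound_None_notin:
  fixes A :: "('a :: {field, finite} \<times> 'a) set"
  assumes p: "prime p" and q: "CARD('a) = p ^ e" and e: "e \<ge> 1"
    and A: "1 < card A" "card A \<le> p ^ e" and None: "None \<notin> directions A"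
    and not_line: "\<nexists>L. is_line L \<and> A \<subseteq> L"
  defines "d \<equiv> card (directions A)" and "u \<equiv> (e + 1) div 2"
  shows "card A < (p ^ (u - 1) + 1) * d \<or> card A < p ^ (e - u) * d"
proof -
  have "p > 1" using p prime_gt_1_nat by blast
  have "u \<le> e" "u \<ge> 1" using e by (auto simp: u_def)
  show ?thesis
  proof (cases "\<forall>y. Some y \<in> directions A \<longrightarrow> card (intercept y ` A) \<le> p ^ (e - u)")
    case True
    then show ?thesis
      using card_less_if_few_lines[OF A(1) None _ not_line] d_def by blast
  next
    case False
    then obtain y where y: "Some y \<in> directions A" "card (intercept y ` A) > p ^ (e - u)"
      by force
    obtain s where s: "s \<le> e" "s < e \<longrightarrow> card A + p ^ s \<le> (p ^ s + 1) * d"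
      "card (intercept y ` A) \<le> p ^ (e - s)"
      using point_bound_and_parallel_line_bound[OF p q A None y(1)] d_def by blast
    \<comment> \<open>Too many parallel lines force \<open>s < u\<close>, hence
      \<open>s < e\<close>, and the point bound becomes available.\<close>
    have "p ^ (e - u) < p ^ (e - s)" using y s by simp
    then have "e - u < e - s" using \<open>p > 1\<close> by simp
    then have "s < e" "s \<le> u - 1" by auto
    have "p ^ s > 0" using \<open>p > 1\<close> by simp
    then have "card A < (p ^ s + 1) * d"
      using s \<open>s < e\<close> by linarith
    also have "\<dots> \<le> (p ^ (u - 1) + 1) * d"
      using \<open>s \<le> u - 1\<close> \<open>p > 1\<close> by (intro mult_le_mono1 add_le_mono1 power_increasing) auto
    finally show ?thesis by blast
  qed
qed

lemma direction_bound:
  fixes A :: "('a :: {field, finite} \<times> 'a) set"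
  assumes p: "prime p" and q: "CARD('a) = p ^ e" and e: "e \<ge> 1"
    and A: "1 < card A" "card A \<le> p ^ e"
    and not_line: "\<nexists>L. is_line L \<and> A \<subseteq> L"
  defines "d \<equiv> card (directions A)" and "u \<equiv> (e + 1) div 2"
  shows "card A < (p ^ (u - 1) + 1) * d \<or> card A < p ^ (e - u) * d"
proof -
  consider "None \<notin> directions A" | "directions A = UNIV"
    | m where "None \<in> directions A" "Some m \<notin> directions A"
    by (metis UNIV_eq_I option.exhaust)
  then show ?thesis
  proof cases
    case 1
    then show ?thesis
      using direction_bound_None_notin[OF p q e A _ not_line] by (simp add: d_def u_def)
  next
    case 2
    \<comment> \<open>If every direction occurs, \<open>d\<close> already exceeds
      \<open>card A\<close>.\<close>
    have "d = p ^ e + 1"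
      using 2 q by (simp add: d_def card_UNIV_option)
    then have "card A < 1 * d" using A by simp
    also have "\<dots> \<le> (p ^ (u - 1) + 1) * d" by (intro mult_le_mono1) auto
    finally show ?thesis by blast
  next
    case m: 3
    \<comment> \<open>This map makes lines of the missing slope \<open>m\<close> vertical: the new
      first coordinate is the intercept for \<open>m\<close>, which is injective on
      \<open>A\<close>.\<close>
    define T where "T = (\<lambda>(x, z). (z - m * x, x))"
    have "inj T" by (auto simp: T_def inj_def)
    then have card_TA: "card (T ` A) = card A"
      by (meson card_image inj_on_subset subset_UNIV)
    have "fst \<circ> T = intercept m"
      by (auto simp: T_def intercept_def)
    then have "inj_on fst (T ` A)"
      using m(2) \<open>inj T\<close> by (metis Some_in_directions_iff inj_on_imageI)
    then have None: "None \<notin> directions (T ` A)"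
      by (simp add: None_in_directions_iff)
    have "\<nexists>L. is_line L \<and> T ` A \<subseteq> L"
    proof
      assume "\<exists>L. is_line L \<and> T ` A \<subseteq> L"
      then obtain a b c where abc: "(a, b) \<noteq> (0, 0)" "T ` A \<subseteq> {(x, z). a * x + b * z = c}"
        unfolding is_line_def by blast
      have "A \<subseteq> {(x, z). (b - a * m) * x + a * z = c}"
        using abc(2) by (auto simp: T_def algebra_simps)
      moreover have "(b - a * m, a) \<noteq> (0, 0)" using abc(1) by auto
      ultimately show False using not_line unfolding is_line_def by blast
    qed
    then have bound: "card (T ` A) < (p ^ (u - 1) + 1) * card (directions (T ` A)) \<or>
        card (T ` A) < p ^ (e - u) * card (directions (T ` A))"
      unfolding u_def
      using direction_bound_None_notin[OF p q e _ _ None] A card_TA by simp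
    \<comment> \<open>The action of \<open>T\<close> on directions: a vertical difference becomes
      horizontal, and slope \<open>t\<close> becomes \<open>1 / (t - m)\<close>. Since
      \<open>m\<close> is not a direction of \<open>A\<close>, the denominator is nonzero on the
      slopes that occur.\<close>
    define g where "g t = (case t of None \<Rightarrow> Some 0 | Some t \<Rightarrow> Some (1 / (t - m)))" for t
    have "directions (T ` A) \<subseteq> g ` directions A"
    proof
      fix t assume t: "t \<in> directions (T ` A)"
      then obtain P Q where PQ: "P \<in> A" "Q \<in> A" "T P \<noteq> T Q" "t = direction (T P) (T Q)"
        unfolding directions_def by blast
      then have "direction P Q \<in> directions A"
        unfolding directions_def by blast
      moreover have "fst (T Q) - fst (T P) \<noteq> 0"
        using t None PQ by (auto simp: direction_def)
      then have "t = g (direction P Q)"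
        using PQ(4) by (auto simp: g_def direction_def T_def field_simps split: prod.splits)
      ultimately show "t \<in> g ` directions A" by blast
    qed
    then have "card (directions (T ` A)) \<le> d"
      unfolding d_def by (rule surj_card_le[rotated]) simp
    then have "(p ^ (u - 1) + 1) * card (directions (T ` A)) \<le> (p ^ (u - 1) + 1) * d"
      "p ^ (e - u) * card (directions (T ` A)) \<le> p ^ (e - u) * d"
      by (rule mult_le_mono2)+
    with bound card_TA show ?thesis by linarith
  qed
qed

theorem theorem1p3:
  fixes p e q :: nat
    and A :: "('a::{field,finite} \<times> 'a) set"
    and D :: "'a option set"
  assumes "prime p"
    and "e \<ge> 1"
    and "q = p ^ e"
    and "CARD('a) = q"
    and "1 < card A"
    and "card A \<le> q"
    and "D = directions A"
  shows "(\<exists>L. is_line L \<and> A \<subseteq> L) \<or>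
    ((even e \<longrightarrow> real (card D) > real (card A) / sqrt (real q)) \<and>
     (odd e \<longrightarrow> real (card D) > real (card A) / (real p ^ ((e - 1) div 2) + 1)))"
proof (cases "\<exists>L. is_line L \<and> A \<subseteq> L")
  case False
  define u where "u = (e + 1) div 2"
  have bound: "card A < (p ^ (u - 1) + 1) * card D \<or> card A < p ^ (e - u) * card D"
    using direction_bound[of p e A] assms False by (simp add: u_def)
  have "p \<ge> 2" using assms(1) prime_ge_2_nat by blast
  have "real (card D) > real (card A) / sqrt (real q)" if "even e"
  proof -
    from that obtain h where h: "e = 2 * h" by (rule evenE)
    have "sqrt (real q) = real p ^ h"
      using \<open>q = p ^ e\<close> h by (intro real_sqrt_unique) (simp_all add: power_mult mult.commute)
    have "h \<ge> 1" "u = h" "e - u = h" using h \<open>e \<ge> 1\<close> by (auto simp: u_def)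
    \<comment> \<open>For even \<open>e\<close> the first alternative is absorbed by the second
      because \<open>p\<close> is at least 2.\<close>
    have "p ^ (h - 1) + 1 \<le> p ^ (h - 1) * 2"
      using \<open>p \<ge> 2\<close> by simp
    also have "\<dots> \<le> p ^ (h - 1) * p"
      using \<open>p \<ge> 2\<close> by (rule mult_le_mono2)
    also have "\<dots> = p ^ h"
      using \<open>h \<ge> 1\<close> by (cases h) auto
    finally have "(p ^ (h - 1) + 1) * card D \<le> p ^ h * card D"
      by (rule mult_le_mono1)
    then have "card A < p ^ h * card D"
      using bound unfolding \<open>e - u = h\<close> unfolding \<open>u = h\<close> by linarith
    then have "real (card A) < real (p ^ h * card D)"
      by (simp only: of_nat_less_iff)
    then have "real (card A) < real p ^ h * real (card D)"
      by simp
    then show ?thesis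
      using \<open>p \<ge> 2\<close> unfolding \<open>sqrt (real q) = real p ^ h\<close> by (simp add: divide_less_eq mult.commute)
  qed
  moreover have "real (card D) > real (card A) / (real p ^ ((e - 1) div 2) + 1)" if "odd e"
  proof -
    from that obtain h where h: "e = 2 * h + 1" by (rule oddE)
    have u: "u - 1 = h" "e - u = h" "(e - 1) div 2 = h" using h by (auto simp: u_def)
    \<comment> \<open>For odd \<open>e\<close> both exponents equal \<open>h\<close>, so the second
      alternative implies the first.\<close>
    have "card A < (p ^ h + 1) * card D"
      using bound u by auto
    then have "real (card A) < real ((p ^ h + 1) * card D)"
      by (simp only: of_nat_less_iff)
    then have "real (card A) < (real p ^ h + 1) * real (card D)"
      by (simp add: algebra_simps)
    moreover have "real p ^ h + 1 > 0"
      by (intro add_nonneg_pos) auto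
    ultimately show ?thesis
      unfolding u(3) by (simp add: divide_less_eq mult.commute)
  qed
  ultimately show ?thesis by blast
qed blast

end
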